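(* Let $A$ be a finite alphabet with $\#(A)\ge 2$, let $L\subseteq A^*$ be a regular language and let $M=M_L$ be its syntactic monoid. Then $L$ is $\mathsf{GD}_A$-measurable if and only if the kernel of $M$ is $\mathcal H$-trivial, i.e. every $\mathcal H$-class of $M$ contained in the kernel of $M$ is a singleton.
   Context: $\#(X)$ denotes the cardinality of a set $X$. For $L\subseteq A^*$, the density is $\delta_A(L)=\lim_{n\to\infty}\frac1n\sum_{k=0}^{n-1}\frac{\#(L\cap A^k)}{\#(A^k)}$ if the limit exists, otherwise $\delta_A(L)=\bot$ (undefined). (Every regular language has a density.) For a family $\mathcal C$ of languages over $A$ and $L\subseteq A^*$, put $\underline{\mu}_{\mathcal C}(L)=\sup\{\delta_A(K): K\subseteq L,\ K\in\mathcal C,\ \delta_A(K)\ne\bot\}$ and $\overline{\mu}_{\mathcal C}(L)=\inf\{\delta_A(K): L\subseteq K,\ K\in\mathcal C,\ \delta_A(K)\ne\bot\}$. $L$ is $\mathcal C$-measurable if $\underline{\mu}_{\mathcal C}(L)=\overline{\mu}_{\mathcal C}(L)$. $\mathsf{GD}_A$ (generalised definite languages) is the Boolean closure (finite unions, finite intersections, complements in $A^*$) of $\{wA^*, A^*w : w\in A^*\}$. The syntactic monoid $M_L$ is the quotient of $A^*$ by the congruence $u\sim v$ iff for all $x,y\in A^*$, $xuy\in L\Leftrightarrow xvy\in L$; it is finite when $L$ is regular. The kernel of a finite monoid $M$ is its unique minimal (two-sided) ideal. Green's relation $\mathcal H$ on $M$: $x\mathrel{\mathcal H}y$ iff $xM=yM$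 and $Mx=My$. *)

theory Defs
  imports Complex_Main "HOL-Library.Cardinality" "HOL-Algebra.Coset"
begin

text \<open>The alphabet is a finite type \<open>'a\<close>, so that the words form the type \<open>'a list\<close>
  and the set of all words is \<open>UNIV\<close>.\<close>

subsection \<open>Regular languages\<close>

text \<open>Recognition by a complete deterministic finite automaton.  Taking the states to be
  natural numbers is no restriction, since the state set is finite.\<close>

definition regular_language :: "'a::finite list set \<Rightarrow> bool" where
  "regular_language L \<longleftrightarrow>
     (\<exists>(Q :: nat set) \<delta> q\<^sub>0 F. finite Q \<and> q\<^sub>0 \<in> Q \<and> F \<subseteq> Q \<and> (\<forall>q\<in>Q. \<forall>a. \<delta> q a \<in> Q) \<and>
        L = {w. foldl \<delta> q\<^sub>0 w \<in> F})"

subsection \<open>Density and measurability\<close>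

definition words_of_length :: "nat \<Rightarrow> 'a::finite list set" where
  "words_of_length k = {w. length w = k}"

definition density_seq :: "'a::finite list set \<Rightarrow> nat \<Rightarrow> real" where
  "density_seq L n =
     (1 / real n) * (\<Sum>k<n. real (card (L \<inter> words_of_length k)) /
                             real (card (words_of_length k :: 'a list set)))"

text \<open>\<^const>\<open>None\<close> stands for an undefined density.\<close>

definition density :: "'a::finite list set \<Rightarrow> real option" where
  "density L = (if convergent (density_seq L) then Some (lim (density_seq L)) else None)"

text \<open>\<^const>\<open>Sup\<close> and \<^const>\<open>Inf\<close> of real sets are only meaningful on nonempty bounded sets.
  Densities lie in the unit interval, and both sets below are nonempty as soon as the family
  contains the empty language and the language of all words.\<close>

definition inner_density :: "'a::finite list set set \<Rightarrow> 'a list set \<Rightarrow> real" where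
  "inner_density \<C> L = Sup {d. \<exists>K\<in>\<C>. K \<subseteq> L \<and> density K = Some d}"

definition outer_density :: "'a::finite list set set \<Rightarrow> 'a list set \<Rightarrow> real" where
  "outer_density \<C> L = Inf {d. \<exists>K\<in>\<C>. L \<subseteq> K \<and> density K = Some d}"

definition language_measurable :: "'a::finite list set set \<Rightarrow> 'a list set \<Rightarrow> bool" where
  "language_measurable \<C> L \<longleftrightarrow> inner_density \<C> L = outer_density \<C> L"

subsection \<open>Generalised definite languages\<close>

inductive_set boolean_closure :: "'b set set \<Rightarrow> 'b set set" for \<B> where
  base: "X \<in> \<B> \<Longrightarrow> X \<in> boolean_closure \<B>"
| empty: "{} \<in> boolean_closure \<B>"
| union: "X \<in> boolean_closure \<B> \<Longrightarrow> Y \<in> boolean_closure \<B> \<Longrightarrow> X \<union> Y \<in> boolean_closure \<B>"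
| inter: "X \<in> boolean_closure \<B> \<Longrightarrow> Y \<in> boolean_closure \<B> \<Longrightarrow> X \<inter> Y \<in> boolean_closure \<B>"
| compl: "X \<in> boolean_closure \<B> \<Longrightarrow> - X \<in> boolean_closure \<B>"

definition generalised_definite :: "'a::finite list set set" where
  "generalised_definite =
     boolean_closure ({range (\<lambda>v. w @ v) | w. True} \<union> {range (\<lambda>v. v @ w) | w. True})"

subsection \<open>The syntactic monoid\<close>

definition syntactic_congruence :: "'a list set \<Rightarrow> ('a list \<times> 'a list) set" where
  "syntactic_congruence L = {(u, v). \<forall>x y. x @ u @ y \<in> L \<longleftrightarrow> x @ v @ y \<in> L}"

text \<open>The union in the multiplication ranges over equal classes, see
  \<open>syntactic_monoid_mult\<close> below.\<close>

definition syntactic_monoid :: "'a list set \<Rightarrow> 'a list set monoid" where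
  "syntactic_monoid L =
     \<lparr>carrier = UNIV // syntactic_congruence L,
      mult = (\<lambda>X Y. \<Union>u\<in>X. \<Union>v\<in>Y. syntactic_congruence L `` {u @ v}),
      one = syntactic_congruence L `` {[]}\<rparr>"

lemma equiv_syntactic_congruence: "equiv UNIV (syntactic_congruence L)"
  by (rule equivI) (auto simp: syntactic_congruence_def refl_on_def sym_def trans_def)

lemma syntactic_congruence_append:
  assumes "(u, u') \<in> syntactic_congruence L" "(v, v') \<in> syntactic_congruence L"
  shows "(u @ v, u' @ v') \<in> syntactic_congruence L"
proof -
  have "x @ (u @ v) @ y \<in> L \<longleftrightarrow> x @ (u' @ v') @ y \<in> L" for x y
  proof -
    have "x @ u @ (v @ y) \<in> L \<longleftrightarrow> x @ u' @ (v @ y) \<in> L"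
      using assms(1) by (auto simp: syntactic_congruence_def)
    moreover have "(x @ u') @ v @ y \<in> L \<longleftrightarrow> (x @ u') @ v' @ y \<in> L"
      using assms(2) unfolding syntactic_congruence_def by blast
    ultimately show ?thesis by simp
  qed
  then show ?thesis by (simp add: syntactic_congruence_def)
qed

lemma syntactic_monoid_mult:
  "syntactic_congruence L `` {u} \<otimes>\<^bsub>syntactic_monoid L\<^esub> syntactic_congruence L `` {v} =
     syntactic_congruence L `` {u @ v}"
proof -
  have "syntactic_congruence L `` {u' @ v'} = syntactic_congruence L `` {u @ v}"
    if "(u, u') \<in> syntactic_congruence L" "(v, v') \<in> syntactic_congruence L" for u' v'
    using syntactic_congruence_append[OF that] equiv_class_eq[OF equiv_syntactic_congruence]
    by metis
  then have "(\<Union>u'\<in>syntactic_congruence L `` {u}. \<Union>v'\<in>syntactic_congruence L `` {v}.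
      syntactic_congruence L `` {u' @ v'}) =
    (\<Union>u'\<in>syntactic_congruence L `` {u}. \<Union>v'\<in>syntactic_congruence L `` {v}.
      syntactic_congruence L `` {u @ v})"
    by (intro SUP_cong refl) (simp only: Image_singleton_iff)
  moreover have "u \<in> syntactic_congruence L `` {u}" "v \<in> syntactic_congruence L `` {v}"
    by (simp_all add: syntactic_congruence_def)
  then have "syntactic_congruence L `` {u} \<noteq> {}" "syntactic_congruence L `` {v} \<noteq> {}"
    by blast+
  ultimately show ?thesis by (simp only: syntactic_monoid_def monoid.simps UN_constant if_False)
qed

lemma monoid_syntactic_monoid: "monoid (syntactic_monoid L)"
proof -
  let ?cl = "\<lambda>u. syntactic_congruence L `` {u}"
  have car: "carrier (syntactic_monoid L) = range ?cl"
    by (auto simp: syntactic_monoid_def quotient_def)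
  have one: "\<one>\<^bsub>syntactic_monoid L\<^esub> = ?cl []" by (simp add: syntactic_monoid_def)
  show ?thesis
    by (rule monoidI) (auto simp: car one syntactic_monoid_mult simp del: Image_singleton_iff)
qed

lemma finite_syntactic_monoid:
  assumes "regular_language L"
  shows "finite (carrier (syntactic_monoid L))"
proof -
  obtain Q :: "nat set" and \<delta> q\<^sub>0 F where Q: "finite Q" "q\<^sub>0 \<in> Q" "\<forall>q\<in>Q. \<forall>a. \<delta> q a \<in> Q"
    and L: "L = {w. foldl \<delta> q\<^sub>0 w \<in> F}"
    using assms unfolding regular_language_def by blast
  define t where "t w = (\<lambda>q. if q \<in> Q then foldl \<delta> q w else undefined)" for w
  have in_Q: "foldl \<delta> q w \<in> Q" if "q \<in> Q" for q w
    using that Q(3) by (induction w arbitrary: q) auto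
  have "range t \<subseteq> PiE Q (\<lambda>_. Q)"
    by (auto simp: t_def in_Q PiE_def extensional_def)
  then have fin: "finite (range t)"
    using Q(1) by (meson finite_PiE finite_subset)
  have "(u, v) \<in> syntactic_congruence L" if "t u = t v" for u v
  proof -
    have "foldl \<delta> q u = foldl \<delta> q v" if "q \<in> Q" for q
      using fun_cong[OF \<open>t u = t v\<close>, of q] that by (simp add: t_def)
    then show ?thesis by (simp add: syntactic_congruence_def L in_Q Q(2))
  qed
  then have eq: "syntactic_congruence L `` {u} = syntactic_congruence L `` {v}"
    if "t u = t v" for u v
    using that equiv_class_eq[OF equiv_syntactic_congruence] by metis
  have "carrier (syntactic_monoid L) \<subseteq>
      (\<lambda>f. syntactic_congruence L `` {SOME w. t w = f}) ` range t"
  proof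
    fix X assume "X \<in> carrier (syntactic_monoid L)"
    then obtain u where X: "X = syntactic_congruence L `` {u}"
      by (auto simp: syntactic_monoid_def quotient_def)
    have "t (SOME w. t w = t u) = t u" by (rule someI) (rule refl)
    then have "X = syntactic_congruence L `` {SOME w. t w = t u}"
      using eq X by metis
    then show "X \<in> (\<lambda>f. syntactic_congruence L `` {SOME w. t w = f}) ` range t" by blast
  qed
  then show ?thesis using fin finite_subset by blast
qed

subsection \<open>The kernel and Green's relation H\<close>

definition monoid_ideal :: "('m, 'b) monoid_scheme \<Rightarrow> 'm set \<Rightarrow> bool" where
  "monoid_ideal M I \<longleftrightarrow> I \<noteq> {} \<and> I \<subseteq> carrier M \<and>
     (\<forall>x\<in>I. \<forall>m\<in>carrier M. m \<otimes>\<^bsub>M\<^esub> x \<in> I \<and> x \<otimes>\<^bsub>M\<^esub> m \<in> I)"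

definition minimal_monoid_ideal :: "('m, 'b) monoid_scheme \<Rightarrow> 'm set \<Rightarrow> bool" where
  "minimal_monoid_ideal M I \<longleftrightarrow>
     monoid_ideal M I \<and> (\<forall>J. monoid_ideal M J \<and> J \<subseteq> I \<longrightarrow> J = I)"

definition monoid_kernel :: "('m, 'b) monoid_scheme \<Rightarrow> 'm set" where
  "monoid_kernel M = (THE I. minimal_monoid_ideal M I)"

lemma ex1_minimal_monoid_ideal:
  assumes "monoid M" "finite (carrier M)"
  shows "\<exists>!I. minimal_monoid_ideal M I"
proof -
  interpret monoid M by fact
  have Int: "monoid_ideal M (I \<inter> J)" if "monoid_ideal M I" "monoid_ideal M J" for I J
  proof -
    have "I \<noteq> {}" "J \<noteq> {}" using that by (simp_all add: monoid_ideal_def)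
    then obtain x y where xy: "x \<in> I" "y \<in> J" by blast
    have "I \<subseteq> carrier M" "J \<subseteq> carrier M" using that by (simp_all add: monoid_ideal_def)
    then have "x \<otimes>\<^bsub>M\<^esub> y \<in> I" "x \<otimes>\<^bsub>M\<^esub> y \<in> J"
      using xy that unfolding monoid_ideal_def by blast+
    then have "I \<inter> J \<noteq> {}" by blast
    then show ?thesis using that unfolding monoid_ideal_def by blast
  qed
  have "{I. monoid_ideal M I} \<subseteq> Pow (carrier M)" by (auto simp: monoid_ideal_def)
  then have fin: "finite {I. monoid_ideal M I}"
    using assms(2) by (meson finite_Pow_iff finite_subset)
  have "monoid_ideal M (carrier M)" by (auto simp: monoid_ideal_def)
  then obtain I where "I \<in> {I. monoid_ideal M I}"
    "\<forall>J\<in>{I. monoid_ideal M I}. J \<subseteq> I \<longrightarrow> I = J"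
    using finite_has_minimal[OF fin] by blast
  then have I: "minimal_monoid_ideal M I" unfolding minimal_monoid_ideal_def by auto
  have "J = I" if "minimal_monoid_ideal M J" for J
  proof -
    have "monoid_ideal M (I \<inter> J)"
      using Int I that by (auto simp: minimal_monoid_ideal_def)
    then have "I \<inter> J = I" "I \<inter> J = J"
      using I that unfolding minimal_monoid_ideal_def by auto
    then show ?thesis by simp
  qed
  with I show ?thesis by blast
qed

text \<open>The cosets \<open>x <#\<^bsub>M\<^esub> carrier M\<close> and \<open>carrier M #>\<^bsub>M\<^esub> x\<close> are the principal right and
  left ideals generated by \<open>x\<close>.\<close>

definition green_H :: "('m, 'b) monoid_scheme \<Rightarrow> ('m \<times> 'm) set" where
  "green_H M = {(x, y). x \<in> carrier M \<and> y \<in> carrier M \<and>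
     x <#\<^bsub>M\<^esub> carrier M = y <#\<^bsub>M\<^esub> carrier M \<and>
     carrier M #>\<^bsub>M\<^esub> x = carrier M #>\<^bsub>M\<^esub> y}"

definition kernel_H_trivial :: "('m, 'b) monoid_scheme \<Rightarrow> bool" where
  "kernel_H_trivial M \<longleftrightarrow>
     (\<forall>C \<in> carrier M // green_H M. C \<subseteq> monoid_kernel M \<longrightarrow> is_singleton C)"

end

theory Submission
  imports Defs
begin

subsection \<open>Green's relation on the kernel of a finite monoid\<close>

text \<open>Write K for the kernel of the syntactic monoid M. A generalised definite language is
  decided, on long words, by a prefix and a suffix of fixed length
  (\<open>generalised_definite_ends_determined\<close>). Its frequency among the words of length k
  is therefore eventually constant, and this constant is its density. Measurability of L thus says
  that for every positive bound there are generalised definite X \<subseteq> L \<subseteq> Y such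
  that the density of Y - X is below it
  (\<open>language_measurable_generalised_definite_iff\<close>).

  The algebra rests on cancellation: in K, an element can be recovered from any of its right
  multiples by right multiplication, and dually on the left. For a, b in K this puts all products a
  m b into one H-class (\<open>kernel_mult_green_H\<close>). If K is H-trivial, a prefix and a
  suffix with classes in K therefore decide membership in L. The words with class outside K are
  closed under factors and miss some word, so their frequency can be made arbitrarily small
  (\<open>factor_closed_word_freq\<close>); hence most long words are decided by their ends.

  Conversely, two distinct H-equivalent elements of K are separated by some context, and by
  \<open>green_H_context\<close> this yields words w, w' with H-equivalent classes in K, exactly one
  of them in L. By \<open>green_H_between\<close>, any ends w a and b w can be completed both to the
  class of w and to that of w'. So Y - X contains every w m w with m long enough, and its density is
  at least the probability of starting and ending with w, whatever X and Y are.\<close>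

lemma l_coset_carrier_eq_iff:
  assumes "monoid M" "x \<in> carrier M" "y \<in> carrier M"
  shows "x <#\<^bsub>M\<^esub> carrier M = y <#\<^bsub>M\<^esub> carrier M \<longleftrightarrow>
    (\<exists>m\<in>carrier M. x = y \<otimes>\<^bsub>M\<^esub> m) \<and> (\<exists>m\<in>carrier M. y = x \<otimes>\<^bsub>M\<^esub> m)"
proof -
  interpret monoid M by fact
  have *: "x <#\<^bsub>M\<^esub> carrier M \<subseteq> y <#\<^bsub>M\<^esub> carrier M \<longleftrightarrow> (\<exists>m\<in>carrier M. x = y \<otimes>\<^bsub>M\<^esub> m)"
    if "x \<in> carrier M" "y \<in> carrier M" for x y
  proof
    assume "x <#\<^bsub>M\<^esub> carrier M \<subseteq> y <#\<^bsub>M\<^esub> carrier M"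
    moreover have "x \<otimes>\<^bsub>M\<^esub> \<one>\<^bsub>M\<^esub> \<in> x <#\<^bsub>M\<^esub> carrier M" unfolding l_coset_def by blast
    ultimately show "\<exists>m\<in>carrier M. x = y \<otimes>\<^bsub>M\<^esub> m" using that unfolding l_coset_def by auto
  next
    assume "\<exists>m\<in>carrier M. x = y \<otimes>\<^bsub>M\<^esub> m"
    then show "x <#\<^bsub>M\<^esub> carrier M \<subseteq> y <#\<^bsub>M\<^esub> carrier M"
      using that by (fastforce simp: l_coset_def m_assoc)
  qed
  show ?thesis using *[of x y] *[of y x] assms by blast
qed

lemma r_coset_carrier_eq_iff:
  assumes "monoid M" "x \<in> carrier M" "y \<in> carrier M"
  shows "carrier M #>\<^bsub>M\<^esub> x = carrier M #>\<^bsub>M\<^esub> y \<longleftrightarrow>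
    (\<exists>m\<in>carrier M. x = m \<otimes>\<^bsub>M\<^esub> y) \<and> (\<exists>m\<in>carrier M. y = m \<otimes>\<^bsub>M\<^esub> x)"
proof -
  interpret monoid M by fact
  have *: "carrier M #>\<^bsub>M\<^esub> x \<subseteq> carrier M #>\<^bsub>M\<^esub> y \<longleftrightarrow> (\<exists>m\<in>carrier M. x = m \<otimes>\<^bsub>M\<^esub> y)"
    if "x \<in> carrier M" "y \<in> carrier M" for x y
  proof
    assume "carrier M #>\<^bsub>M\<^esub> x \<subseteq> carrier M #>\<^bsub>M\<^esub> y"
    moreover have "\<one>\<^bsub>M\<^esub> \<otimes>\<^bsub>M\<^esub> x \<in> carrier M #>\<^bsub>M\<^esub> x" unfolding r_coset_def by blast
    ultimately show "\<exists>m\<in>carrier M. x = m \<otimes>\<^bsub>M\<^esub> y" using that unfolding r_coset_def by auto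
  next
    assume "\<exists>m\<in>carrier M. x = m \<otimes>\<^bsub>M\<^esub> y"
    then show "carrier M #>\<^bsub>M\<^esub> x \<subseteq> carrier M #>\<^bsub>M\<^esub> y"
      using that by (fastforce simp: r_coset_def m_assoc[symmetric])
  qed
  show ?thesis using *[of x y] *[of y x] assms by blast
qed

locale finite_monoid = monoid M for M (structure) +
  assumes finite_carrier: "finite (carrier M)"
begin

abbreviation "K \<equiv> monoid_kernel M"

lemma green_H_iff:
  "(x, y) \<in> green_H M \<longleftrightarrow> x \<in> carrier M \<and> y \<in> carrier M \<and>
    (\<exists>m\<in>carrier M. x = y \<otimes> m) \<and> (\<exists>m\<in>carrier M. y = x \<otimes> m) \<and>
    (\<exists>m\<in>carrier M. x = m \<otimes> y) \<and> (\<exists>m\<in>carrier M. y = m \<otimes> x)"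
  by (simp add: green_H_def l_coset_carrier_eq_iff[OF monoid_axioms]
      r_coset_carrier_eq_iff[OF monoid_axioms] cong: conj_cong)

lemma minimal_kernel: "minimal_monoid_ideal M K"
  unfolding monoid_kernel_def
  by (rule theI') (rule ex1_minimal_monoid_ideal[OF monoid_axioms finite_carrier])

lemma kernel_carrier: "x \<in> K \<Longrightarrow> x \<in> carrier M"
  and kernel_mult_right: "x \<in> K \<Longrightarrow> m \<in> carrier M \<Longrightarrow> x \<otimes> m \<in> K"
  and kernel_mult_left: "x \<in> K \<Longrightarrow> m \<in> carrier M \<Longrightarrow> m \<otimes> x \<in> K"
  and kernel_nonempty: "K \<noteq> {}"
  using minimal_kernel unfolding minimal_monoid_ideal_def monoid_ideal_def by blast+

text \<open>The products s z t form an ideal inside the kernel, so minimality makes it the whole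
  kernel.\<close>

lemma kernel_generated:
  assumes "z \<in> K" "a \<in> K"
  obtains s t where "s \<in> carrier M" "t \<in> carrier M" "a = s \<otimes> z \<otimes> t"
proof -
  have z: "z \<in> carrier M" using assms(1) by (rule kernel_carrier)
  let ?J = "{s \<otimes> z \<otimes> t | s t. s \<in> carrier M \<and> t \<in> carrier M}"
  have "monoid_ideal M ?J"
    unfolding monoid_ideal_def
  proof (intro conjI ballI)
    show "?J \<noteq> {}" by blast
    show "?J \<subseteq> carrier M" using z by auto
    fix x m assume "x \<in> ?J" and m: "m \<in> carrier M"
    then obtain s t where st: "s \<in> carrier M" "t \<in> carrier M" and x: "x = s \<otimes> z \<otimes> t" by blast
    have "m \<otimes> x = (m \<otimes> s) \<otimes> z \<otimes> t" "x \<otimes> m = s \<otimes> z \<otimes> (t \<otimes> m)"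
      using st m z by (simp_all add: x m_assoc)
    then show "m \<otimes> x \<in> ?J" "x \<otimes> m \<in> ?J" using st m by blast+
  qed
  moreover have "?J \<subseteq> K" using assms(1) by (auto intro: kernel_mult_left kernel_mult_right)
  ultimately have "?J = K" using minimal_kernel unfolding minimal_monoid_ideal_def by blast
  then show thesis using assms(2) that by blast
qed

section \<open>Cancellation in the kernel\<close>

lemma power_eq_power:
  assumes "r \<in> carrier M"
  obtains i d :: nat where "r [^] (i + Suc d) = r [^] i"
proof -
  have "\<not> inj (\<lambda>n::nat. r [^] n)"
  proof
    assume "inj (\<lambda>n::nat. r [^] n)"
    then have "infinite (range (\<lambda>n::nat. r [^] n))" by (simp add: finite_image_iff)
    moreover have "range (\<lambda>n::nat. r [^] n) \<subseteq> carrier M" using assms by auto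
    ultimately show False using finite_carrier finite_subset by blast
  qed
  then obtain i j :: nat where ij: "r [^] i = r [^] j" "i \<noteq> j" unfolding inj_def by blast
  then show thesis
    using that[of i "j - Suc i"] that[of j "i - Suc j"] by (cases i j rule: linorder_cases) auto
qed

text \<open>Iteration gives a = s^n a r^n for all n. Once n reaches the periodic part of the powers
  of r, another period of r on the right changes nothing; likewise for s on the left. The exponent
  is positive so that one factor can be split off later.\<close>

lemma absorb_powers:
  assumes "s \<in> carrier M" "a \<in> carrier M" "r \<in> carrier M" "a = s \<otimes> a \<otimes> r"
  shows "\<exists>d::nat. a = a \<otimes> r [^] Suc d" and "\<exists>d::nat. a = s [^] Suc d \<otimes> a"
proof -
  have pow: "a = s [^] n \<otimes> a \<otimes> r [^] n" for n :: nat
  proof (induction n)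
    case 0 then show ?case using assms(1-3) by simp
  next
    case (Suc n)
    have "a = s [^] n \<otimes> (s \<otimes> a \<otimes> r) \<otimes> r [^] n" using Suc assms(4) by metis
    also have "\<dots> = s [^] Suc n \<otimes> a \<otimes> (r \<otimes> r [^] n)" using assms(1-3) by (simp add: m_assoc)
    also have "r \<otimes> r [^] n = r [^] Suc n" using assms(3) nat_pow_Suc2 by simp
    finally show ?case .
  qed
  obtain i d :: nat where i: "r [^] (i + Suc d) = r [^] i" using power_eq_power assms(3) by blast
  have "a \<otimes> r [^] Suc d = (s [^] i \<otimes> a \<otimes> r [^] i) \<otimes> r [^] Suc d" using pow[of i] by simp
  also have "\<dots> = s [^] i \<otimes> a \<otimes> r [^] (i + Suc d)"
    using assms(1-3) by (simp only: nat_pow_mult[symmetric] m_assoc nat_pow_closed m_closed)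
  also have "\<dots> = a" using pow[of i] i by simp
  finally show "\<exists>d::nat. a = a \<otimes> r [^] Suc d" by metis
  obtain i d :: nat where i: "s [^] (i + Suc d) = s [^] i" using power_eq_power assms(1) by blast
  have "s [^] Suc d \<otimes> a = s [^] Suc d \<otimes> (s [^] i \<otimes> a \<otimes> r [^] i)" using pow[of i] by simp
  also have "\<dots> = s [^] (Suc d + i) \<otimes> a \<otimes> r [^] i"
    using assms(1-3) by (simp only: nat_pow_mult[symmetric] m_assoc nat_pow_closed m_closed)
  also have "\<dots> = a" using pow[of i] i by (simp add: add.commute)
  finally show "\<exists>d::nat. a = s [^] Suc d \<otimes> a" by metis
qed

text \<open>The product a m is still in the kernel, hence generates a, say a = s a (m t). Absorbing
  powers removes s and leaves a = a (m t)^(d+1), a right multiple of a m.\<close>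

lemma kernel_right_cancel:
  assumes "a \<in> K" "m \<in> carrier M"
  shows "\<exists>t\<in>carrier M. a = a \<otimes> m \<otimes> t"
proof -
  have a: "a \<in> carrier M" using assms(1) by (rule kernel_carrier)
  obtain s t where st: "s \<in> carrier M" "t \<in> carrier M" "a = s \<otimes> (a \<otimes> m) \<otimes> t"
    using kernel_generated[OF kernel_mult_right[OF assms] assms(1)] by blast
  then have "a = s \<otimes> a \<otimes> (m \<otimes> t)" using a assms(2) by (simp add: m_assoc)
  then obtain d :: nat where "a = a \<otimes> (m \<otimes> t) [^] Suc d"
    using absorb_powers(1)[of s a "m \<otimes> t"] st a assms(2) by auto
  also have "\<dots> = a \<otimes> ((m \<otimes> t) \<otimes> (m \<otimes> t) [^] d)"
    using st assms(2) by (simp only: nat_pow_Suc2 m_closed)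
  also have "\<dots> = a \<otimes> m \<otimes> (t \<otimes> (m \<otimes> t) [^] d)" using st a assms(2) by (simp add: m_assoc)
  finally show ?thesis using st assms(2) by (metis m_closed nat_pow_closed)
qed

lemma kernel_left_cancel:
  assumes "a \<in> K" "m \<in> carrier M"
  shows "\<exists>s\<in>carrier M. a = s \<otimes> (m \<otimes> a)"
proof -
  have a: "a \<in> carrier M" using assms(1) by (rule kernel_carrier)
  obtain s t where st: "s \<in> carrier M" "t \<in> carrier M" "a = s \<otimes> (m \<otimes> a) \<otimes> t"
    using kernel_generated[OF kernel_mult_left[OF assms] assms(1)] by blast
  then have "a = (s \<otimes> m) \<otimes> a \<otimes> t" using a assms(2) by (simp add: m_assoc)
  then obtain d :: nat where "a = (s \<otimes> m) [^] Suc d \<otimes> a"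
    using absorb_powers(2)[of "s \<otimes> m" a t] st a assms(2) by auto
  also have "\<dots> = ((s \<otimes> m) [^] d \<otimes> s) \<otimes> (m \<otimes> a)" using st a assms(2) by (simp add: m_assoc)
  finally show ?thesis using st assms(2) by (metis m_closed nat_pow_closed)
qed

text \<open>Cancellation with m = x gives x = x x t, to which \<open>absorb_powers\<close> applies
  with s = a = x.\<close>

lemma kernel_regular:
  assumes "x \<in> K"
  shows "\<exists>m\<in>carrier M. x = x \<otimes> m \<otimes> x"
proof -
  have x: "x \<in> carrier M" using assms by (rule kernel_carrier)
  obtain t where t: "t \<in> carrier M" "x = x \<otimes> x \<otimes> t" using kernel_right_cancel[OF assms x] by blast
  then obtain d :: nat where d: "x = x [^] Suc d \<otimes> x" using absorb_powers(2)[of x x t] x by auto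
  have "x [^] Suc d \<otimes> x = x \<otimes> x [^] d \<otimes> x" using x by (simp only: nat_pow_Suc2)
  then show ?thesis using d x by (metis nat_pow_closed)
qed

section \<open>H-classes inside the kernel\<close>

text \<open>By cancellation a is a right multiple of a m' b, hence so is a m b; dually b is a left
  multiple of a m' b. The roles of m and m' are symmetric.\<close>

lemma kernel_mult_green_H:
  assumes "a \<in> K" "b \<in> K" "m \<in> carrier M" "m' \<in> carrier M"
  shows "(a \<otimes> m \<otimes> b, a \<otimes> m' \<otimes> b) \<in> green_H M"
proof -
  have c: "a \<in> carrier M" "b \<in> carrier M" using assms kernel_carrier by blast+
  have "\<exists>n\<in>carrier M. a \<otimes> m \<otimes> b = a \<otimes> m' \<otimes> b \<otimes> n" if m: "m \<in> carrier M" "m' \<in> carrier M" for m m'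
  proof -
    obtain t where t: "t \<in> carrier M" "a = a \<otimes> (m' \<otimes> b) \<otimes> t"
      using kernel_right_cancel[OF assms(1) m_closed[OF m(2) c(2)]] by blast
    then have "a \<otimes> m \<otimes> b = (a \<otimes> (m' \<otimes> b) \<otimes> t) \<otimes> m \<otimes> b" by simp
    also have "\<dots> = a \<otimes> m' \<otimes> b \<otimes> (t \<otimes> m \<otimes> b)" using t(1) m c by (simp add: m_assoc)
    finally show ?thesis using t(1) m c by blast
  qed
  moreover have "\<exists>n\<in>carrier M. a \<otimes> m \<otimes> b = n \<otimes> (a \<otimes> m' \<otimes> b)"
    if m: "m \<in> carrier M" "m' \<in> carrier M" for m m'
  proof -
    obtain t where t: "t \<in> carrier M" "b = t \<otimes> (a \<otimes> m' \<otimes> b)"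
      using kernel_left_cancel[OF assms(2) m_closed[OF c(1) m(2)]] by blast
    then have "a \<otimes> m \<otimes> b = a \<otimes> m \<otimes> (t \<otimes> (a \<otimes> m' \<otimes> b))" by simp
    also have "\<dots> = (a \<otimes> m \<otimes> t) \<otimes> (a \<otimes> m' \<otimes> b)" using t(1) m c by (simp add: m_assoc)
    finally show ?thesis using t(1) m c by blast
  qed
  ultimately show ?thesis
    using assms(3,4) c unfolding green_H_iff by (meson m_closed)
qed

lemma green_H_kernel:
  assumes "x \<in> K" "(x, y) \<in> green_H M"
  shows "y \<in> K"
  using assms(2) kernel_mult_right[OF assms(1)] unfolding green_H_iff by metis

text \<open>In a general monoid H is not compatible with multiplication. Here it is, because
  cancellation undoes the factors t and s before x is rewritten through y. This transports an
  H-equivalent pair into a context that separates it.\<close>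

lemma green_H_context:
  assumes "x \<in> K" "(x, y) \<in> green_H M" "s \<in> carrier M" "t \<in> carrier M"
  shows "(s \<otimes> x \<otimes> t, s \<otimes> y \<otimes> t) \<in> green_H M"
proof -
  have *: "\<exists>n\<in>carrier M. s \<otimes> x \<otimes> t = s \<otimes> y \<otimes> t \<otimes> n" "\<exists>n\<in>carrier M. s \<otimes> x \<otimes> t = n \<otimes> (s \<otimes> y \<otimes> t)"
    if y: "y \<in> K" and m: "m \<in> carrier M" "x = y \<otimes> m" "n \<in> carrier M" "x = n \<otimes> y" for x y m n
  proof -
    have c: "y \<in> carrier M" using y by (rule kernel_carrier)
    obtain u where u: "u \<in> carrier M" "y = y \<otimes> t \<otimes> u" using kernel_right_cancel[OF y assms(4)] by blast
    have "s \<otimes> x \<otimes> t = s \<otimes> (y \<otimes> t \<otimes> u \<otimes> m) \<otimes> t" using u m by simp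
    also have "\<dots> = s \<otimes> y \<otimes> t \<otimes> (u \<otimes> m \<otimes> t)" using u(1) m(1) c assms(3,4) by (simp add: m_assoc)
    finally show "\<exists>n\<in>carrier M. s \<otimes> x \<otimes> t = s \<otimes> y \<otimes> t \<otimes> n" using u(1) m(1) assms(4) by blast
    obtain v where v: "v \<in> carrier M" "y = v \<otimes> (s \<otimes> y)" using kernel_left_cancel[OF y assms(3)] by blast
    have "s \<otimes> x \<otimes> t = s \<otimes> (n \<otimes> (v \<otimes> (s \<otimes> y))) \<otimes> t" using v m by simp
    also have "\<dots> = (s \<otimes> n \<otimes> v) \<otimes> (s \<otimes> y \<otimes> t)" using v(1) m(3) c assms(3,4) by (simp add: m_assoc)
    finally show "\<exists>n\<in>carrier M. s \<otimes> x \<otimes> t = n \<otimes> (s \<otimes> y \<otimes> t)" using v(1) m(3) assms(3) by blast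
  qed
  have y: "y \<in> K" using assms(1,2) by (rule green_H_kernel)
  obtain m m' n n' where "m \<in> carrier M" "x = y \<otimes> m" "m' \<in> carrier M" "y = x \<otimes> m'"
    "n \<in> carrier M" "x = n \<otimes> y" "n' \<in> carrier M" "y = n' \<otimes> x"
    using assms(2) unfolding green_H_iff by blast
  then show ?thesis
    using *[of y m x n] *[of x m' y n'] y assms(1,3,4) kernel_carrier[of x] kernel_carrier[of y]
    unfolding green_H_iff by (meson m_closed)
qed

text \<open>By regularity y = y w y. The left y is written as x r, the right one as s x, and
  cancellation then exhibits x m at the front and n x at the back.\<close>

lemma green_H_between:
  assumes "x \<in> K" "(x, y) \<in> green_H M" "m \<in> carrier M" "n \<in> carrier M"
  shows "\<exists>z\<in>carrier M. y = (x \<otimes> m) \<otimes> z \<otimes> (n \<otimes> x)"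
proof -
  have y: "y \<in> K" using assms(1,2) by (rule green_H_kernel)
  have c: "x \<in> carrier M" using assms(1) by (rule kernel_carrier)
  obtain p where p: "p \<in> carrier M" "x = x \<otimes> m \<otimes> p" using kernel_right_cancel[OF assms(1,3)] by blast
  obtain q where q: "q \<in> carrier M" "x = q \<otimes> (n \<otimes> x)" using kernel_left_cancel[OF assms(1,4)] by blast
  obtain r where r: "r \<in> carrier M" "y = x \<otimes> r"
    using assms(2) unfolding green_H_iff by blast
  obtain s where s: "s \<in> carrier M" "y = s \<otimes> x"
    using assms(2) unfolding green_H_iff by blast
  obtain w where w: "w \<in> carrier M" "y = y \<otimes> w \<otimes> y" using kernel_regular[OF y] by blast
  have "y = (x \<otimes> r) \<otimes> w \<otimes> (s \<otimes> x)" using w(2) r(2) s(2) by simp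
  also have "\<dots> = (x \<otimes> m \<otimes> p \<otimes> r) \<otimes> w \<otimes> (s \<otimes> (q \<otimes> (n \<otimes> x)))" using p(2) q(2) by simp
  also have "\<dots> = (x \<otimes> m) \<otimes> (p \<otimes> r \<otimes> w \<otimes> s \<otimes> q) \<otimes> (n \<otimes> x)"
    using p(1) q(1) r(1) s(1) w(1) c assms(3,4) by (simp add: m_assoc)
  finally show ?thesis using p(1) q(1) r(1) s(1) w(1) by blast
qed

text \<open>An H-class that meets the kernel lies inside it, so triviality can be tested on pairs of
  elements.\<close>

lemma kernel_H_trivial_iff:
  "kernel_H_trivial M \<longleftrightarrow> (\<forall>x\<in>K. \<forall>y. (x, y) \<in> green_H M \<longrightarrow> x = y)"
proof
  assume triv: "kernel_H_trivial M"
  show "\<forall>x\<in>K. \<forall>y. (x, y) \<in> green_H M \<longrightarrow> x = y"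
  proof (intro ballI allI impI)
    fix x y assume x: "x \<in> K" and xy: "(x, y) \<in> green_H M"
    have "green_H M `` {x} \<in> carrier M // green_H M" using x kernel_carrier by (auto simp: quotient_def)
    moreover have "green_H M `` {x} \<subseteq> K" using green_H_kernel[OF x] by blast
    ultimately obtain z where "green_H M `` {x} = {z}"
      using triv unfolding kernel_H_trivial_def is_singleton_def by blast
    moreover have "(x, x) \<in> green_H M" using x kernel_carrier by (simp add: green_H_def)
    ultimately have "x \<in> {z}" "y \<in> {z}" using xy by (metis ImageI singletonI)+
    then show "x = y" by simp
  qed
next
  assume eq: "\<forall>x\<in>K. \<forall>y. (x, y) \<in> green_H M \<longrightarrow> x = y"
  show "kernel_H_trivial M"
    unfolding kernel_H_trivial_def
  proof (intro ballI impI)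
    fix C assume "C \<in> carrier M // green_H M" and C: "C \<subseteq> K"
    then obtain x where x: "x \<in> carrier M" "C = green_H M `` {x}" by (auto simp: quotient_def)
    then have "(x, x) \<in> green_H M" by (simp add: green_H_def)
    then have "C = {x}" using eq C x(2) by blast
    then show "is_singleton C" by (simp add: is_singleton_def)
  qed
qed

end

subsection \<open>Frequencies of words\<close>

text \<open>The summand of \<open>density_seq\<close>: the probability that a uniformly random word
  of length k lies in X.\<close>

definition word_freq :: "'a::finite list set \<Rightarrow> nat \<Rightarrow> real" where
  "word_freq X k =
     real (card (X \<inter> words_of_length k)) / real (card (words_of_length k :: 'a list set))"

lemma finite_words_of_length [simp]: "finite (words_of_length k :: 'a::finite list set)"
  using finite_lists_length_eq[of "UNIV :: 'a set" k] by (simp add: words_of_length_def)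

lemma card_words_of_length: "card (words_of_length k :: 'a::finite list set) = CARD('a) ^ k"
  using card_lists_length_eq[of "UNIV :: 'a set" k] by (simp add: words_of_length_def)

lemma word_freq_mono:
  assumes "X \<inter> words_of_length k \<subseteq> Y"
  shows "word_freq X k \<le> word_freq Y k"
proof -
  have "card (X \<inter> words_of_length k) \<le> card (Y \<inter> words_of_length k)"
    using assms by (intro card_mono) auto
  then show ?thesis by (simp add: word_freq_def divide_right_mono)
qed

lemma word_freq_nonneg: "0 \<le> word_freq X k"
  by (simp add: word_freq_def)

lemma word_freq_UNIV [simp]: "word_freq UNIV k = 1"
  by (simp add: word_freq_def card_words_of_length)

lemma word_freq_Un_le: "word_freq (X \<union> Y) k \<le> word_freq X k + word_freq Y k"
proof -
  have "card ((X \<union> Y) \<inter> words_of_length k)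
      \<le> card (X \<inter> words_of_length k) + card (Y \<inter> words_of_length k)"
    by (metis Int_Un_distrib2 card_Un_le)
  then have "real (card ((X \<union> Y) \<inter> words_of_length k))
      \<le> real (card (X \<inter> words_of_length k)) + real (card (Y \<inter> words_of_length k))"
    by linarith
  then show ?thesis
    unfolding word_freq_def add_divide_distrib[symmetric] by (rule divide_right_mono) simp
qed

lemma word_freq_Diff:
  assumes "X \<subseteq> Y"
  shows "word_freq (Y - X) k = word_freq Y k - word_freq X k"
proof -
  have "card (X \<inter> words_of_length k) \<le> card (Y \<inter> words_of_length k)"
    using assms by (intro card_mono) auto
  moreover have "(Y - X) \<inter> words_of_length k = Y \<inter> words_of_length k - X \<inter> words_of_length k" by blast
  then have "card ((Y - X) \<inter> words_of_length k)
      = card (Y \<inter> words_of_length k) - card (X \<inter> words_of_length k)"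
    using assms by (metis Int_mono card_Diff_subset finite_Int finite_words_of_length order_refl)
  ultimately show ?thesis by (simp add: word_freq_def of_nat_diff diff_divide_distrib)
qed

text \<open>Fixing both lengths makes the factorisation unique, so frequencies multiply like
  probabilities of independent events.\<close>

definition concat_words :: "'a::finite list set \<Rightarrow> nat \<Rightarrow> 'a list set \<Rightarrow> nat \<Rightarrow> 'a list set" where
  "concat_words X m Y n =
     (\<lambda>(u, v). u @ v) ` ((X \<inter> words_of_length m) \<times> (Y \<inter> words_of_length n))"

lemma word_freq_concat: "word_freq (concat_words X m Y n) (m + n) = word_freq X m * word_freq Y n"
proof -
  have "inj_on (\<lambda>(u, v). u @ v) ((X \<inter> words_of_length m) \<times> (Y \<inter> words_of_length n))"
    by (auto simp: inj_on_def words_of_length_def)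
  then have "card (concat_words X m Y n)
      = card (X \<inter> words_of_length m) * card (Y \<inter> words_of_length n)"
    by (simp add: concat_words_def card_image card_cartesian_product)
  moreover have "concat_words X m Y n \<inter> words_of_length (m + n) = concat_words X m Y n"
    by (auto simp: concat_words_def words_of_length_def)
  ultimately show ?thesis by (simp add: word_freq_def card_words_of_length power_add)
qed

lemma word_freq_singleton: "word_freq {w :: 'a::finite list} (length w) = 1 / real CARD('a) ^ length w"
proof -
  have "{w} \<inter> words_of_length (length w) = {w}" by (auto simp: words_of_length_def)
  then show ?thesis by (simp add: word_freq_def card_words_of_length)
qed

text \<open>Cutting words in two shows that the frequency is submultiplicative in the length. It is
  below 1 at the length of w, hence bounded by its powers along the multiples of that
  length.\<close>

lemma factor_closed_word_freq:
  fixes B :: "'a::finite list set"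
  assumes B: "\<And>u v. u @ v \<in> B \<Longrightarrow> u \<in> B \<and> v \<in> B" and w: "w \<notin> B" and e: "0 < \<epsilon>"
  shows "\<exists>n. word_freq B n < \<epsilon>"
proof -
  let ?l = "length w"
  have sub: "word_freq B (m + n) \<le> word_freq B m * word_freq B n" for m n
  proof -
    have "B \<inter> words_of_length (m + n) \<subseteq> concat_words B m B n"
    proof
      fix v assume v: "v \<in> B \<inter> words_of_length (m + n)"
      then have "take m v \<in> B \<and> drop m v \<in> B" by (intro B) simp
      with v have "(take m v, drop m v) \<in> (B \<inter> words_of_length m) \<times> (B \<inter> words_of_length n)"
        by (simp add: words_of_length_def)
      then show "v \<in> concat_words B m B n"
        unfolding concat_words_def by (rule rev_image_eqI) simp
    qed
    then show ?thesis using word_freq_mono word_freq_concat by metis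
  qed
  have "B \<inter> words_of_length ?l \<subset> words_of_length ?l"
    using w by (auto simp: words_of_length_def)
  then have "card (B \<inter> words_of_length ?l) < card (words_of_length ?l :: 'a list set)"
    by (intro psubset_card_mono) auto
  then have lt: "word_freq B ?l < 1" by (simp add: word_freq_def card_words_of_length)
  have "word_freq B (i * ?l) \<le> word_freq B ?l ^ i" for i
  proof (induction i)
    case 0
    show ?case using word_freq_mono[of B 0 UNIV] by simp
  next
    case (Suc i)
    have "word_freq B (Suc i * ?l) \<le> word_freq B ?l * word_freq B (i * ?l)" using sub by simp
    also have "\<dots> \<le> word_freq B ?l * word_freq B ?l ^ i"
      using Suc word_freq_nonneg by (rule mult_left_mono)
    finally show ?case by simp
  qed
  moreover obtain i where "word_freq B ?l ^ i < \<epsilon>"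
    using real_arch_pow_inv[OF e lt] by blast
  ultimately show ?thesis using le_less_trans by blast
qed

text \<open>The deviations of the first N terms add up to the constant \<open>?S\<close>, which the
  averaging divides by n.\<close>

lemma density_eventually_const:
  assumes "\<And>k. N \<le> k \<Longrightarrow> word_freq X k = c"
  shows "density X = Some c"
proof -
  let ?S = "\<Sum>k<N. word_freq X k - c"
  \<comment> \<open>The bound 1 excludes n = 0, where division by zero makes
    \<open>density_seq\<close> vanish.\<close>
  have "density_seq X n = c + ?S / real n" if n: "max N 1 \<le> n" for n
  proof -
    have "(\<Sum>k<n. word_freq X k - c) = ?S"
      using n assms by (intro sum.mono_neutral_right) auto
    then have "(\<Sum>k<n. word_freq X k) = real n * c + ?S" by (simp add: sum_subtractf)
    moreover have "density_seq X n = (\<Sum>k<n. word_freq X k) / real n"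
      by (simp add: density_seq_def word_freq_def)
    ultimately show ?thesis using n by (simp add: add_divide_distrib)
  qed
  then have "eventually (\<lambda>n. c + ?S / real n = density_seq X n) sequentially"
    by (metis (mono_tags, lifting) eventually_sequentiallyI)
  moreover have "(\<lambda>n. c + ?S / real n) \<longlonglongrightarrow> c + 0"
    by (intro tendsto_add tendsto_const lim_const_over_n)
  ultimately have "density_seq X \<longlonglongrightarrow> c" by (simp add: Lim_transform_eventually)
  then show ?thesis by (simp add: density_def convergentI limI)
qed

subsection \<open>Generalised definite languages\<close>

text \<open>The two ends do not overlap, so words shorter than 2n are unconstrained. An implication
  suffices because \<open>m\<close> and \<open>m'\<close> can be exchanged.\<close>

definition ends_determined :: "nat \<Rightarrow> 'a list set \<Rightarrow> bool" where
  "ends_determined n X \<longleftrightarrow> (\<forall>u v m m'. length u = n \<longrightarrow> length v = n \<longrightarrow>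
     u @ m @ v \<in> X \<longrightarrow> u @ m' @ v \<in> X)"

lemma ends_determined_mono:
  assumes "ends_determined n X" "n \<le> n'"
  shows "ends_determined n' X"
  unfolding ends_determined_def
proof (intro allI impI)
  fix u v m m' :: "'a list"
  assume l: "length u = n'" "length v = n'" and X: "u @ m @ v \<in> X"
  let ?u = "take n u" and ?v = "drop (n' - n) v"
  have *: "u @ z @ v = ?u @ (drop n u @ z @ take (n' - n) v) @ ?v" for z
    by (metis append.assoc append_take_drop_id)
  have "length ?u = n" "length ?v = n" using l assms(2) by simp_all
  then show "u @ m' @ v \<in> X"
    using assms(1) X unfolding ends_determined_def by (subst *, subst (asm) *) blast
qed

lemma generalised_definite_ends_determined:
  assumes "X \<in> generalised_definite"
  shows "\<exists>n. ends_determined n X"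
  using assms unfolding generalised_definite_def
proof (induction rule: boolean_closure.induct)
  case (base X)
  then obtain w where "X = range (\<lambda>v. w @ v) \<or> X = range (\<lambda>v. v @ w)" by blast
  then have "ends_determined (length w) X"
  proof
    assume X: "X = range (\<lambda>v. w @ v)"
    show ?thesis by (auto simp: ends_determined_def X)
  next
    assume X: "X = range (\<lambda>v. v @ w)"
    have "u @ m' @ v \<in> X" if l: "length v = length w" and "u @ m @ v \<in> X" for u v m m'
    proof -
      obtain z where "(u @ m) @ v = z @ w" using \<open>u @ m @ v \<in> X\<close> unfolding X by auto
      then have "v = w" using l append_eq_append_conv by metis
      then have "u @ m' @ v = (u @ m') @ w" by simp
      then show ?thesis unfolding X by (rule range_eqI)
    qed
    then show ?thesis unfolding ends_determined_def by blast
  qed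
  then show ?case by blast
next
  case empty
  then show ?case by (simp add: ends_determined_def)
next
  case (union X Y)
  then obtain m n where "ends_determined m X" "ends_determined n Y" by blast
  then have "ends_determined (max m n) X" "ends_determined (max m n) Y"
    using ends_determined_mono max.cobounded1 max.cobounded2 by blast+
  then have "ends_determined (max m n) (X \<union> Y)" unfolding ends_determined_def by blast
  then show ?case by blast
next
  case (inter X Y)
  then obtain m n where "ends_determined m X" "ends_determined n Y" by blast
  then have "ends_determined (max m n) X" "ends_determined (max m n) Y"
    using ends_determined_mono max.cobounded1 max.cobounded2 by blast+
  then have "ends_determined (max m n) (X \<inter> Y)" unfolding ends_determined_def by blast
  then show ?case by blast
next
  case (compl X)
  then obtain n where "ends_determined n X" by blast
  then have "ends_determined n (- X)" unfolding ends_determined_def by blast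
  then show ?case by blast
qed

text \<open>For length 2n + j, the words of X are the admissible pairs of ends with an arbitrary
  middle of length j. The number of middles cancels against the total number of words.\<close>

lemma ends_determined_word_freq:
  fixes X :: "'a::finite list set"
  assumes "ends_determined n X" "2 * n \<le> k"
  shows "word_freq X k = word_freq X (2 * n)"
proof -
  let ?S = "{(u, v). length u = n \<and> length v = n \<and> u @ v \<in> X}"
  have "card (X \<inter> words_of_length (2 * n + j)) = card ?S * CARD('a) ^ j" for j
  proof -
    let ?f = "\<lambda>((u, v), m). u @ m @ v"
    have "X \<inter> words_of_length (2 * n + j) = ?f ` (?S \<times> words_of_length j)"
    proof (intro equalityI subsetI)
      fix w assume w: "w \<in> X \<inter> words_of_length (2 * n + j)"
      let ?u = "take n w" and ?m = "take j (drop n w)" and ?v = "drop j (drop n w)"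
      have eq: "w = ?u @ ?m @ ?v" by (metis append_take_drop_id)
      have l: "length ?u = n" "length ?m = j" "length ?v = n"
        using w by (simp_all add: words_of_length_def)
      have "?u @ ?m @ ?v \<in> X" using w eq by (metis IntD1)
      \<comment> \<open>The set \<open>?S\<close> tests a pair of ends with the empty middle, as any
        middle gives the same answer.\<close>
      then have "?u @ [] @ ?v \<in> X" using assms(1) l unfolding ends_determined_def by blast
      then have "((?u, ?v), ?m) \<in> ?S \<times> words_of_length j"
        using l by (simp add: words_of_length_def)
      moreover have "w = ?f ((?u, ?v), ?m)" unfolding prod.case by (rule eq)
      ultimately show "w \<in> ?f ` (?S \<times> words_of_length j)" by (rule rev_image_eqI)
    next
      fix w assume "w \<in> ?f ` (?S \<times> words_of_length j)"
      then obtain u v m where w: "w = u @ m @ v" "length m = j" and uv: "length u = n" "length v = n"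
        and "u @ [] @ v \<in> X"
        by (auto simp: words_of_length_def)
      then have "w \<in> X" using assms(1) unfolding ends_determined_def by blast
      then show "w \<in> X \<inter> words_of_length (2 * n + j)" using w uv by (simp add: words_of_length_def)
    qed
    moreover have "inj_on ?f (?S \<times> words_of_length j)"
      by (auto simp: inj_on_def words_of_length_def)
    ultimately show ?thesis by (simp add: card_image card_cartesian_product card_words_of_length)
  qed
  then have "word_freq X (2 * n + j) = real (card ?S) / real CARD('a) ^ (2 * n)" for j
    by (simp add: word_freq_def card_words_of_length power_add)
  from this[of "k - 2 * n"] this[of 0] show ?thesis using assms(2) by simp
qed

lemma generalised_definite_density:
  assumes "X \<in> generalised_definite"
  obtains d N where "density X = Some d" "\<And>k. N \<le> k \<Longrightarrow> word_freq X k = d"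
  using generalised_definite_ends_determined[OF assms] ends_determined_word_freq
    density_eventually_const by metis

section \<open>Closure properties of the generalised definite languages\<close>

lemma generalised_definite_empty: "{} \<in> generalised_definite"
  and generalised_definite_compl: "X \<in> generalised_definite \<Longrightarrow> - X \<in> generalised_definite"
  and generalised_definite_Un:
    "X \<in> generalised_definite \<Longrightarrow> Y \<in> generalised_definite \<Longrightarrow> X \<union> Y \<in> generalised_definite"
  and generalised_definite_Int:
    "X \<in> generalised_definite \<Longrightarrow> Y \<in> generalised_definite \<Longrightarrow> X \<inter> Y \<in> generalised_definite"
  unfolding generalised_definite_def by (fact boolean_closure.intros)+

lemma generalised_definite_Diff:
  "X \<in> generalised_definite \<Longrightarrow> Y \<in> generalised_definite \<Longrightarrow> X - Y \<in> generalised_definite"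
  unfolding Diff_eq by (intro generalised_definite_Int generalised_definite_compl)

lemma generalised_definite_UNIV: "UNIV \<in> generalised_definite"
  using generalised_definite_compl[OF generalised_definite_empty] by simp

lemma generalised_definite_UN:
  assumes "finite I" "\<And>i. i \<in> I \<Longrightarrow> X i \<in> generalised_definite"
  shows "(\<Union>i\<in>I. X i) \<in> generalised_definite"
  using assms by (induction I) (auto intro: generalised_definite_empty generalised_definite_Un)

lemma generalised_definite_prefix: "range (\<lambda>v. w @ v) \<in> generalised_definite"
  and generalised_definite_suffix: "range (\<lambda>v. v @ w) \<in> generalised_definite"
  unfolding generalised_definite_def by (rule boolean_closure.base, blast)+

text \<open>Having prefix u and suffix v also allows overlaps. A lower bound on the length excludes
  them, and the words obeying it form a finite union of prefix languages.\<close>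

lemma generalised_definite_prefix_suffix:
  fixes u v :: "'a::finite list"
  shows "range (\<lambda>m. u @ m @ v) \<in> generalised_definite"
proof -
  let ?n = "length u + length v"
  have long: "(\<Union>w\<in>words_of_length ?n. range (\<lambda>z. w @ z)) = {w :: 'a list. ?n \<le> length w}"
  proof (intro equalityI subsetI)
    fix w :: "'a list" assume "w \<in> {w. ?n \<le> length w}"
    then have "take ?n w \<in> words_of_length ?n" by (simp add: words_of_length_def)
    moreover have "w = take ?n w @ drop ?n w" by simp
    ultimately show "w \<in> (\<Union>w\<in>words_of_length ?n. range (\<lambda>z. w @ z))" by blast
  qed (auto simp: words_of_length_def)
  have "range (\<lambda>m. u @ m @ v) =
      range (\<lambda>z. u @ z) \<inter> range (\<lambda>z. z @ v) \<inter> {w. ?n \<le> length w}"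
  proof (intro equalityI subsetI)
    fix w assume "w \<in> range (\<lambda>z. u @ z) \<inter> range (\<lambda>z. z @ v) \<inter> {w. ?n \<le> length w}"
    then obtain y z where w: "w = u @ y" "w = z @ v" "?n \<le> length w" by blast
    then have "u = take (length u) z"
      by (metis add_le_imp_le_right append_eq_append_conv_if length_append)
    then have "w = u @ drop (length u) z @ v" using w(2) by (metis append.assoc append_take_drop_id)
    then show "w \<in> range (\<lambda>m. u @ m @ v)" by blast
  next
    fix w assume "w \<in> range (\<lambda>m. u @ m @ v)"
    then obtain m where w: "w = u @ m @ v" by blast
    then have "w \<in> range (\<lambda>z. u @ z)" by blast
    moreover have "w = (u @ m) @ v" using w by simp
    then have "w \<in> range (\<lambda>z. z @ v)" by blast
    ultimately show "w \<in> range (\<lambda>z. u @ z) \<inter> range (\<lambda>z. z @ v) \<inter> {w. ?n \<le> length w}"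
      using w by simp
  qed
  then show ?thesis
    unfolding long[symmetric]
    by (simp add: generalised_definite_Int generalised_definite_prefix generalised_definite_suffix
        generalised_definite_UN)
qed

section \<open>Measurability through pairs of approximations\<close>

lemma density_Diff:
  assumes "X \<in> generalised_definite" "Y \<in> generalised_definite" "X \<subseteq> Y"
    and "density X = Some c" "density Y = Some d"
  shows "density (Y - X) = Some (d - c)" and "c \<le> d"
proof -
  obtain M N where M: "\<And>k. M \<le> k \<Longrightarrow> word_freq X k = c" and N: "\<And>k. N \<le> k \<Longrightarrow> word_freq Y k = d"
    using generalised_definite_density[OF assms(1)] generalised_definite_density[OF assms(2)] assms(4,5)
    by (metis option.inject)
  have eq: "word_freq (Y - X) k = d - c" if "max M N \<le> k" for k
    using M[of k] N[of k] that word_freq_Diff[OF assms(3)] by simp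
  then show "density (Y - X) = Some (d - c)" by (rule density_eventually_const)
  show "c \<le> d" using eq[of "max M N"] word_freq_nonneg[of "Y - X" "max M N"] by simp
qed

text \<open>Every inner density is at most every outer one, so supremum and infimum agree iff the
  gaps get arbitrarily small; by \<open>density_Diff\<close> such a gap is the density of Y -
  X.\<close>

lemma language_measurable_generalised_definite_iff:
  fixes L :: "'a::finite list set"
  shows "language_measurable generalised_definite L \<longleftrightarrow>
    (\<forall>\<epsilon>>0. \<exists>X\<in>generalised_definite. \<exists>Y\<in>generalised_definite. X \<subseteq> L \<and> L \<subseteq> Y \<and>
       (\<exists>d<\<epsilon>. density (Y - X) = Some d))"
  (is "_ \<longleftrightarrow> ?R")
proof -
  let ?I = "{d. \<exists>K\<in>generalised_definite. K \<subseteq> L \<and> density K = Some d}"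
  let ?O = "{d. \<exists>K\<in>generalised_definite. L \<subseteq> K \<and> density K = Some d}"
  \<comment> \<open>The empty language and the language of all words make both sets nonempty, and
    each provides a bound for the other set.\<close>
  obtain c0 where "density ({} :: 'a list set) = Some c0"
    using generalised_definite_density[OF generalised_definite_empty] by metis
  then have c0: "c0 \<in> ?I" using generalised_definite_empty by auto
  obtain d0 where "density (UNIV :: 'a list set) = Some d0"
    using generalised_definite_density[OF generalised_definite_UNIV] by metis
  then have d0: "d0 \<in> ?O" using generalised_definite_UNIV by auto
  have ne: "?I \<noteq> {}" "?O \<noteq> {}" using c0 d0 by blast+
  have le: "c \<le> d" if "c \<in> ?I" "d \<in> ?O" for c d
  proof -
    obtain X Y where "X \<in> generalised_definite" "X \<subseteq> L" "density X = Some c"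
      "Y \<in> generalised_definite" "L \<subseteq> Y" "density Y = Some d"
      using \<open>c \<in> ?I\<close> \<open>d \<in> ?O\<close> by blast
    then show ?thesis using density_Diff(2)[of X Y c d] by simp
  qed
  have bdd: "bdd_above ?I" "bdd_below ?O"
    by (rule bdd_aboveI, erule le[OF _ d0]) (rule bdd_belowI, erule le[OF c0])
  have "Sup ?I \<le> Inf ?O" by (intro cSup_least cInf_greatest ne le)
  have "Sup ?I = Inf ?O \<longleftrightarrow> ?R"
  proof
    assume eq: "Sup ?I = Inf ?O"
    show ?R
    proof (intro allI impI)
      fix \<epsilon> :: real assume e: "\<epsilon> > 0"
      obtain c where c: "c \<in> ?I" "Sup ?I - \<epsilon> / 2 < c"
        using less_cSup_iff[OF ne(1) bdd(1), of "Sup ?I - \<epsilon> / 2"] e by auto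
      obtain d where d: "d \<in> ?O" "d < Inf ?O + \<epsilon> / 2"
        using cInf_less_iff[OF ne(2) bdd(2), of "Inf ?O + \<epsilon> / 2"] e by auto
      obtain X Y where XY: "X \<in> generalised_definite" "X \<subseteq> L" "density X = Some c"
        "Y \<in> generalised_definite" "L \<subseteq> Y" "density Y = Some d"
        using c(1) d(1) by blast
      then have "density (Y - X) = Some (d - c)" using density_Diff(1) by blast
      moreover have "d - c < \<epsilon>" using c(2) d(2) eq by simp
      ultimately show "\<exists>X\<in>generalised_definite. \<exists>Y\<in>generalised_definite. X \<subseteq> L \<and> L \<subseteq> Y \<and>
          (\<exists>d<\<epsilon>. density (Y - X) = Some d)"
        using XY by blast
    qed
  next
    assume R: ?R
    show "Sup ?I = Inf ?O"
    proof (rule ccontr)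
      assume "Sup ?I \<noteq> Inf ?O"
      then have "Inf ?O - Sup ?I > 0" using \<open>Sup ?I \<le> Inf ?O\<close> by simp
      then obtain X Y d where XY: "X \<in> generalised_definite" "Y \<in> generalised_definite" "X \<subseteq> L" "L \<subseteq> Y"
        and d: "d < Inf ?O - Sup ?I" "density (Y - X) = Some d"
        using R by blast
      obtain c c' where c: "density X = Some c" "density Y = Some c'"
        using generalised_definite_density XY by metis
      then have "d = c' - c" using density_Diff(1)[of X Y c c'] XY d(2) by auto
      moreover have "c \<le> Sup ?I" using XY c by (intro cSup_upper bdd) blast
      moreover have "Inf ?O \<le> c'" using XY c by (intro cInf_lower bdd) blast
      ultimately show False using d(1) by simp
    qed
  qed
  then show ?thesis by (simp only: language_measurable_def inner_density_def outer_density_def)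
qed

subsection \<open>Measurability and the kernel\<close>

abbreviation syntactic_class :: "'a list set \<Rightarrow> 'a list \<Rightarrow> 'a list set" where
  "syntactic_class L w \<equiv> syntactic_congruence L `` {w}"

lemma carrier_syntactic_monoid: "carrier (syntactic_monoid L) = range (syntactic_class L)"
  by (auto simp: syntactic_monoid_def quotient_def)

lemma syntactic_class_eq_iff:
  "syntactic_class L u = syntactic_class L v \<longleftrightarrow> (\<forall>x y. x @ u @ y \<in> L \<longleftrightarrow> x @ v @ y \<in> L)"
  using eq_equiv_class_iff[OF equiv_syntactic_congruence, of u v L]
  by (simp add: syntactic_congruence_def)

lemma syntactic_class_eq_mem:
  "syntactic_class L u = syntactic_class L v \<Longrightarrow> u \<in> L \<longleftrightarrow> v \<in> L"
  unfolding syntactic_class_eq_iff by (metis append.right_neutral append_Nil)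

locale regular =
  fixes L :: "'a::finite list set"
  assumes regular: "regular_language L"
begin

sublocale finite_monoid "syntactic_monoid L"
  using finite_syntactic_monoid[OF regular] monoid_syntactic_monoid
  by (simp add: finite_monoid_def finite_monoid_axioms_def)

abbreviation "cl \<equiv> syntactic_class L"

lemma cl_carrier: "cl w \<in> carrier (syntactic_monoid L)"
  unfolding carrier_syntactic_monoid by blast

lemmas cl_mult = syntactic_monoid_mult[of L, symmetric]

lemma cl_append_kernel:
  assumes "cl u \<in> K"
  shows "cl (u @ v) \<in> K" "cl (v @ u) \<in> K"
  unfolding cl_mult by (intro kernel_mult_left kernel_mult_right cl_carrier assms)+

text \<open>When the kernel is \<open>\<H>\<close>-trivial, a prefix and a suffix that both reach the kernel already
  determine the class of the whole word, and random long words have such a prefix and suffix.\<close>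

lemma kernel_H_trivial_imp_measurable:
  assumes "kernel_H_trivial (syntactic_monoid L)"
  shows "language_measurable generalised_definite L"
  unfolding language_measurable_generalised_definite_iff
proof (intro allI impI)
  fix \<epsilon> :: real assume e: "\<epsilon> > 0"
  let ?B = "{w. cl w \<notin> K}"
  \<comment> \<open>The middle m is compared with the empty middle: both products lie in one H-class
    of the kernel, hence coincide.\<close>
  have mid: "u @ m @ v \<in> L \<longleftrightarrow> u @ v \<in> L" if "cl u \<in> K" "cl v \<in> K" for u m v
  proof -
    have "(cl u \<otimes>\<^bsub>syntactic_monoid L\<^esub> cl m \<otimes>\<^bsub>syntactic_monoid L\<^esub> cl v,
        cl u \<otimes>\<^bsub>syntactic_monoid L\<^esub> cl [] \<otimes>\<^bsub>syntactic_monoid L\<^esub> cl v) \<in> green_H (syntactic_monoid L)"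
      using that by (intro kernel_mult_green_H cl_carrier)
    moreover have "cl u \<otimes>\<^bsub>syntactic_monoid L\<^esub> cl m \<otimes>\<^bsub>syntactic_monoid L\<^esub> cl v \<in> K"
      using that by (intro kernel_mult_right cl_carrier)
    ultimately have "cl ((u @ m) @ v) = cl ((u @ []) @ v)"
      using assms unfolding kernel_H_trivial_iff cl_mult by blast
    then show ?thesis using syntactic_class_eq_mem[of L "u @ m @ v" "u @ v"] by (simp only: append_assoc append_Nil)
  qed
  obtain x where "x \<in> K" using kernel_nonempty by blast
  then obtain w where w: "cl w \<in> K"
    using kernel_carrier unfolding carrier_syntactic_monoid by blast
  have factor: "u \<in> ?B \<and> v \<in> ?B" if "u @ v \<in> ?B" for u v
    using that cl_append_kernel(1)[of u v] cl_append_kernel(2)[of v u] by blast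
  have "w \<notin> ?B" using w by blast
  then obtain n where n: "word_freq ?B n < \<epsilon> / 2"
    using factor_closed_word_freq[OF factor _ half_gt_zero[OF e]] by blast
  \<comment> \<open>Pairs of ends in the kernel, sorted by their verdict b. \<open>X True\<close> is
    the inner approximation, the complement of \<open>X False\<close> the outer one.\<close>
  define S where "S b = {(u, v). u \<in> words_of_length n \<and> v \<in> words_of_length n \<and>
    cl u \<in> K \<and> cl v \<in> K \<and> (u @ v \<in> L \<longleftrightarrow> b)}" for b
  define X where "X b = (\<Union>(u, v)\<in>S b. range (\<lambda>m. u @ m @ v))" for b
  have "S b \<subseteq> words_of_length n \<times> words_of_length n" for b by (auto simp: S_def)
  then have "finite (S b)" for b by (rule finite_subset) simp
  then have gd: "X b \<in> generalised_definite" for b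
    unfolding X_def
    by (rule generalised_definite_UN) (auto intro: generalised_definite_prefix_suffix)
  have sub: "X True \<subseteq> L" "L \<subseteq> - X False" using mid by (auto simp: X_def S_def)
  have gdD: "- X False - X True \<in> generalised_definite"
    using gd by (intro generalised_definite_Diff generalised_definite_compl)
  obtain d N where d: "density (- X False - X True) = Some d"
    and N: "\<And>k. N \<le> k \<Longrightarrow> word_freq (- X False - X True) k = d"
    using generalised_definite_density[OF gdD] by blast
  \<comment> \<open>Long enough for the frequency of the gap to equal d and for the two ends of
    length n not to overlap.\<close>
  define k where "k = N + 2 * n"
  \<comment> \<open>An undecided word has a prefix or a suffix of length n outside the kernel, each
    with probability below half of the bound.\<close>
  have "(- X False - X True) \<inter> words_of_length (n + (k - n))
      \<subseteq> concat_words ?B n UNIV (k - n) \<union> concat_words UNIV (k - n) ?B n"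
  proof
    fix w assume w: "w \<in> (- X False - X True) \<inter> words_of_length (n + (k - n))"
    then have l: "length w = k" by (simp add: words_of_length_def k_def)
    let ?u = "take n w" and ?m = "take (k - 2 * n) (drop n w)" and ?v = "drop (k - n) w"
    have "drop (k - 2 * n) (drop n w) = ?v" by (simp add: k_def add.commute)
    then have eq: "w = ?u @ ?m @ ?v" by (metis append_take_drop_id)
    have "length ?u = n" "length ?v = n" using l by (simp_all add: k_def)
    then have uv: "?u \<in> words_of_length n" "?v \<in> words_of_length n" by (simp_all add: words_of_length_def)
    have "w \<notin> X b" for b using w by (cases b) auto
    then have "(?u, ?v) \<notin> S b" for b using eq unfolding X_def by fast
    then consider "?u \<in> ?B" | "?v \<in> ?B" using uv unfolding S_def by blast
    then show "w \<in> concat_words ?B n UNIV (k - n) \<union> concat_words UNIV (k - n) ?B n"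
    proof cases
      case 1
      then have "(?u, drop n w) \<in> (?B \<inter> words_of_length n) \<times> (UNIV \<inter> words_of_length (k - n))"
        using uv l by (simp add: words_of_length_def)
      then have "w \<in> concat_words ?B n UNIV (k - n)"
        unfolding concat_words_def by (rule rev_image_eqI) simp
      then show ?thesis ..
    next
      case 2
      then have "(take (k - n) w, ?v) \<in> (UNIV \<inter> words_of_length (k - n)) \<times> (?B \<inter> words_of_length n)"
        using uv l by (simp add: words_of_length_def)
      then have "w \<in> concat_words UNIV (k - n) ?B n"
        unfolding concat_words_def by (rule rev_image_eqI) simp
      then show ?thesis ..
    qed
  qed
  then have "word_freq (- X False - X True) (n + (k - n))
      \<le> word_freq (concat_words ?B n UNIV (k - n) \<union> concat_words UNIV (k - n) ?B n) (n + (k - n))"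
    by (rule word_freq_mono)
  also have "\<dots> \<le> word_freq (concat_words ?B n UNIV (k - n)) (n + (k - n))
      + word_freq (concat_words UNIV (k - n) ?B n) ((k - n) + n)"
    using word_freq_Un_le by (metis add.commute)
  also have "\<dots> < \<epsilon>" using n by (simp add: word_freq_concat)
  finally have "d < \<epsilon>" using N[of "n + (k - n)"] by (simp add: k_def)
  then show "\<exists>X\<in>generalised_definite. \<exists>Y\<in>generalised_definite. X \<subseteq> L \<and> L \<subseteq> Y \<and>
      (\<exists>d<\<epsilon>. density (Y - X) = Some d)"
    using d gd sub generalised_definite_compl by blast
qed

text \<open>A long prefix starting with \<open>w\<close> and a long suffix ending with \<open>w\<close> can be completed both to
  the class of \<open>w\<close> and to that of \<open>w'\<close>, hence never decide membership in \<open>L\<close>.  So the gap between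
  inner and outer approximations contains all sufficiently long words that begin and end with \<open>w\<close>.\<close>

lemma not_measurable:
  assumes w: "cl w \<in> K" and H: "(cl w, cl w') \<in> green_H (syntactic_monoid L)"
    and L: "(w \<in> L) \<noteq> (w' \<in> L)"
  shows "\<not> language_measurable generalised_definite L"
proof
  let ?l = "length w"
  \<comment> \<open>The probability that a random word of length at least \<open>2 * ?l\<close>
    begins and ends with w.\<close>
  let ?e = "1 / real CARD('a) ^ ?l * (1 / real CARD('a) ^ ?l)"
  assume "language_measurable generalised_definite L"
  moreover have "?e > 0" by simp
  ultimately obtain X Y d where XY: "X \<in> generalised_definite" "Y \<in> generalised_definite" "X \<subseteq> L" "L \<subseteq> Y"
    and d: "d < ?e" "density (Y - X) = Some d"
    unfolding language_measurable_generalised_definite_iff by blast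
  obtain N where N: "\<And>k. N \<le> k \<Longrightarrow> word_freq (Y - X) k = d"
    using generalised_definite_density[OF generalised_definite_Diff[OF XY(2,1)]] d(2) by (metis option.inject)
  obtain n1 n2 where "ends_determined n1 X" "ends_determined n2 Y"
    using generalised_definite_ends_determined XY by blast
  \<comment> \<open>Adding \<open>?l\<close> ensures that w fits into each end of length n.\<close>
  moreover define n where "n = n1 + n2 + ?l"
  ultimately have ends: "ends_determined n X" "ends_determined n Y"
    by (auto elim: ends_determined_mono)
  define j where "j = N + 2 * n"
  have "w @ m @ w \<in> Y - X" if m: "length m = j" for m
  proof -
    \<comment> \<open>Here a and b extend w to a prefix and a suffix of length exactly n, and c is
      the rest of m.\<close>
    let ?k = "length (w @ m @ w)"
    define a where "a = take (n - ?l) m"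
    define b where "b = drop (j - (n - ?l)) m"
    define c where "c = take (j - (n - ?l) - (n - ?l)) (drop (n - ?l) m)"
    have "m = a @ c @ b"
    proof -
      have "b = drop (j - (n - ?l) - (n - ?l)) (drop (n - ?l) m)" by (simp add: b_def j_def)
      then show ?thesis unfolding a_def c_def by (metis append_take_drop_id)
    qed
    then have eq: "w @ m @ w = (w @ a) @ c @ (b @ w)" by simp
    have l: "length (w @ a) = n" "length (b @ w) = n"
      using m by (simp_all add: a_def b_def j_def n_def)
    have between: "\<exists>z. cl ((w @ a) @ z @ (b @ w)) = y" if y: "(cl w, y) \<in> green_H (syntactic_monoid L)" for y
    proof -
      obtain x where x: "x \<in> carrier (syntactic_monoid L)"
        "y = cl w \<otimes>\<^bsub>syntactic_monoid L\<^esub> cl a \<otimes>\<^bsub>syntactic_monoid L\<^esub> x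
          \<otimes>\<^bsub>syntactic_monoid L\<^esub> (cl b \<otimes>\<^bsub>syntactic_monoid L\<^esub> cl w)"
        using green_H_between[OF w y cl_carrier cl_carrier] by blast
      obtain z where "x = cl z" using x(1) unfolding carrier_syntactic_monoid by blast
      then have "y = cl (((w @ a) @ z) @ (b @ w))" using x(2) by (simp only: syntactic_monoid_mult)
      then show ?thesis by (metis append.assoc)
    qed
    have "(cl w, cl w) \<in> green_H (syntactic_monoid L)" using cl_carrier by (simp add: green_H_def)
    then obtain z z' where "cl ((w @ a) @ z @ (b @ w)) = cl w" "cl ((w @ a) @ z' @ (b @ w)) = cl w'"
      using between H by metis
    then have "((w @ a) @ z @ (b @ w) \<in> L) \<noteq> ((w @ a) @ z' @ (b @ w) \<in> L)"
      using L syntactic_class_eq_mem by blast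
    then obtain p q where "(w @ a) @ p @ (b @ w) \<in> L" "(w @ a) @ q @ (b @ w) \<notin> L" by blast
    \<comment> \<open>One completion in L and one outside L fix the verdicts of Y and X for these
      ends, hence for the middle c as well.\<close>
    then have "(w @ a) @ p @ (b @ w) \<in> Y" "(w @ a) @ q @ (b @ w) \<notin> X" using XY by blast+
    then have "(w @ a) @ c @ (b @ w) \<in> Y" "(w @ a) @ c @ (b @ w) \<notin> X"
      using ends l unfolding ends_determined_def by blast+
    then show ?thesis unfolding eq by blast
  qed
  then have "concat_words {w} ?l (concat_words UNIV j {w} ?l) (j + ?l) \<subseteq> Y - X"
    by (auto simp: concat_words_def words_of_length_def)
  then have "word_freq (concat_words {w} ?l (concat_words UNIV j {w} ?l) (j + ?l)) (?l + (j + ?l))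
      \<le> word_freq (Y - X) (?l + (j + ?l))"
    by (intro word_freq_mono) blast
  then have "?e \<le> word_freq (Y - X) (?l + (j + ?l))" by (simp only: word_freq_concat word_freq_singleton word_freq_UNIV mult_1)
  also have "\<dots> = d" by (rule N) (simp add: j_def)
  finally show False using d(1) by simp
qed

text \<open>Distinct syntactic classes are separated by a context. Placing H-equivalent kernel
  elements in it keeps them H-equivalent and in the kernel, so \<open>not_measurable\<close>
  applies.\<close>

lemma measurable_imp_kernel_H_trivial:
  assumes "language_measurable generalised_definite L"
  shows "kernel_H_trivial (syntactic_monoid L)"
  unfolding kernel_H_trivial_iff
proof (intro ballI allI impI)
  fix x y assume x: "x \<in> K" and xy: "(x, y) \<in> green_H (syntactic_monoid L)"
  then have "x \<in> range cl" "y \<in> range cl"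
    unfolding carrier_syntactic_monoid[symmetric] green_H_def by blast+
  then obtain u v where uv: "x = cl u" "y = cl v" by blast
  show "x = y"
  proof (rule ccontr)
    assume "x \<noteq> y"
    then obtain s t where st: "(s @ u @ t \<in> L) \<noteq> (s @ v @ t \<in> L)"
      unfolding uv syntactic_class_eq_iff by blast
    have "cl ((s @ u) @ t) \<in> K" using x unfolding uv by (intro cl_append_kernel)
    moreover have "(cl ((s @ u) @ t), cl ((s @ v) @ t)) \<in> green_H (syntactic_monoid L)"
      using x xy unfolding uv cl_mult by (intro green_H_context cl_carrier)
    ultimately show False using not_measurable[of "s @ u @ t" "s @ v @ t"] st assms by simp
  qed
qed

end

theorem theorem17:
  fixes L :: "'a::finite list set"
  assumes "CARD('a) \<ge> 2"
    and "regular_language L"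
  shows "language_measurable generalised_definite L \<longleftrightarrow> kernel_H_trivial (syntactic_monoid L)"
proof -
  interpret regular L by standard (fact assms(2))
  show ?thesis using kernel_H_trivial_imp_measurable measurable_imp_kernel_H_trivial by blast
qed

end
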